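(* Let $\mathbf{a}=(a_1,a_2,\ldots,a_k)\in\mathbb{Z}_{\geq 1}^k$ be a composition of $n$. Then the number of weakly flattened Fubini rankings with runs of weak ascents that have reduced content $\mathbf{a}$ is $$\sum_{j_2=0}^{a_2}\left[\binom{a_1+a_2-j_2-2}{a_2-j_2}\sum_{j_3=0}^{a_3}\left[\binom{a_1+j_2+a_3-j_3-2}{a_3-j_3}\sum_{j_4=0}^{a_4}\left[\cdots\sum_{j_k=0}^{a_k}\left[\binom{a_1+a_k-j_k-2+\sum_{r=2}^{k-1}j_r}{a_k-j_k}\right]\cdots\right]\right]\right],$$ that is, the sum over all integer tuples $(j_2,\ldots,j_k)$ with $0\le j_i\le a_i$ of $\prod_{i=2}^{k}\binom{a_1+\sum_{r=2}^{i-1}j_r+a_i-j_i-2}{a_i-j_i}$.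
   Context: Let $[n]=\{1,2,\ldots,n\}$. A Fubini ranking of length $n$ is a tuple $r=(r_1,\ldots,r_n)\in[n]^n$ that records a valid ranking of $n$ competitors with ties allowed, where if exactly $k$ competitors are tied at rank $i$, then the next $k-1$ ranks $i+1,\ldots,i+k-1$ are disallowed; equivalently, $r_i=1+|\{j : r_j<r_i\}|$ for every $i\in[n]$. The content of a Fubini ranking of length $n$ is the tuple $(c_1,\ldots,c_n)$ where $c_i$ is the number of competitors with rank $i$ (the number of entries equal to $i$); the reduced content is obtained from the content by deleting all entries equal to $0$. A run of weak ascents of a word $w=w_1\cdots w_n$ is a maximal contiguous subword $w_iw_{i+1}\cdots w_j$ with $w_l\le w_{l+1}$ for all $i\le l\le j-1$. A Fubini ranking is weakly flattened with runs of weak ascents if the leading (first) terms of its runs of weak ascents, read from left to right, are in weakly increasing order. A composition of $n$ is a tuple of positive integers with sum $n$. Binomial coefficients $\binom{m}{0}$ equal $1$ for every integer $m$ (including $m=-1$), and an empty nested sum (case $k=1$) is read as $1$. *)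

theory Defs
  imports Complex_Main "HOL-Library.FuncSet"
begin

text \<open>Words are lists; positions in a list are counted from 0, while ranks are counted from 1.\<close>

definition fubini_ranking :: "nat \<Rightarrow> nat list \<Rightarrow> bool" where
  "fubini_ranking n r \<longleftrightarrow>
     length r = n \<and> set r \<subseteq> {1..n} \<and>
     (\<forall>i<n. r ! i = 1 + card {j. j < n \<and> r ! j < r ! i})"

definition content :: "nat \<Rightarrow> nat list \<Rightarrow> nat list" where
  "content n r = map (\<lambda>i. count_list r i) [1..<Suc n]"

definition reduced_content :: "nat \<Rightarrow> nat list \<Rightarrow> nat list" where
  "reduced_content n r = filter (\<lambda>c. c \<noteq> 0) (content n r)"

text \<open>A contiguous subword is given by its first position \<open>i\<close> and its last position \<open>j\<close>
  (inclusive), so that equal subwords at different places are kept apart.\<close>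

definition weakly_ascending_between :: "nat list \<Rightarrow> nat \<Rightarrow> nat \<Rightarrow> bool" where
  "weakly_ascending_between w i j \<longleftrightarrow>
     i \<le> j \<and> j < length w \<and> (\<forall>l. i \<le> l \<and> l < j \<longrightarrow> w ! l \<le> w ! (l + 1))"

definition weak_ascent_run :: "nat list \<Rightarrow> nat \<Rightarrow> nat \<Rightarrow> bool" where
  "weak_ascent_run w i j \<longleftrightarrow>
     weakly_ascending_between w i j \<and>
     (\<forall>i' j'. i' \<le> i \<and> j \<le> j' \<and> weakly_ascending_between w i' j' \<longrightarrow> i' = i \<and> j' = j)"

definition weakly_flattened :: "nat list \<Rightarrow> bool" where
  "weakly_flattened w \<longleftrightarrow>
     (\<forall>i j i' j'. weak_ascent_run w i j \<and> weak_ascent_run w i' j' \<and> i \<le> i' \<longrightarrow> w ! i \<le> w ! i')"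

end

theory Submission
  imports Defs
begin

text \<open>
  Call a letter of a word a \<^emph>\<open>right-to-left minimum\<close> if no later letter is smaller. A letter that
  starts a run of weak ascents is a lower bound for its run, so the leading terms of the runs
  increase weakly exactly if each of them is a right-to-left minimum
  (\<open>weakly_flattened_iff_starts_minimal\<close>). Apart from the first letter, the leading terms are the
  descent bottoms. Hence a word is weakly flattened iff it is \<open>x # u\<close> with \<open>x\<close> a least letter and
  every descent bottom of \<open>u\<close> a right-to-left minimum of \<open>u\<close> (\<open>weakly_flattened_Cons\<close>).

  Such words \<open>u\<close> are counted by inserting the letters in increasing order. Let \<open>w\<close> be a word of
  this kind with \<open>R\<close> right-to-left minima, and insert \<open>t\<close> copies of a letter \<open>c\<close> larger than all
  letters of \<open>w\<close>. A copy of \<open>c\<close> that is not in the final block of copies of \<open>c\<close> makes the next old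
  letter a descent bottom, so it must stand in the gap just before one of the \<open>R\<close> right-to-left minima;
  a copy at the end is free, and is a new right-to-left minimum. If \<open>j\<close> copies go to the end, the
  other \<open>t - j\<close> form a multiset of gaps before the \<open>R\<close> minima, which gives
  \<open>R + (t - j) - 1\<close> choose \<open>t - j\<close> words with \<open>R + j\<close> right-to-left minima
  (\<open>sum_insertions\<close>). Starting from \<open>a 1 - 1\<close> copies of the least letter, since one copy is the
  leading \<open>x\<close>, and iterating, yields the nested sum (\<open>sum_words_with\<close>).

  Finally, a Fubini ranking has reduced content \<open>a\<close> iff it is a rearrangement of the word with
  \<open>a i\<close> copies of the rank \<open>1 + a 1 + \<dots> + a (i - 1)\<close> for each \<open>i\<close>
  (\<open>fubini_reduced_content_imp_words_with\<close> and \<open>words_with_imp_fubini_reduced_content\<close>), and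
  these ranks increase with \<open>i\<close>.
\<close>

section \<open>Weakly flattened words\<close>

text \<open>The first letter is not a descent bottom, so it is unconstrained.\<close>

fun descents_to_minima :: "'a::linorder list \<Rightarrow> bool" where
  "descents_to_minima [] \<longleftrightarrow> True"
| "descents_to_minima [x] \<longleftrightarrow> True"
| "descents_to_minima (x # y # w) \<longleftrightarrow>
     (x \<le> y \<or> (\<forall>z\<in>set w. y \<le> z)) \<and> descents_to_minima (y # w)"

text \<open>The minima are weak: of several equal letters, each can be one.\<close>

fun rl_minima :: "'a::linorder list \<Rightarrow> nat" where
  "rl_minima [] = 0"
| "rl_minima (x # w) = (if \<forall>z\<in>set w. x \<le> z then Suc (rl_minima w) else rl_minima w)"

lemma descents_to_minima_Cons:
  "descents_to_minima (x # w) \<longleftrightarrow>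
     descents_to_minima w \<and> (w = [] \<or> x \<le> hd w \<or> (\<forall>z\<in>set (tl w). hd w \<le> z))"
  by (cases w) auto

text \<open>Runs of weak ascents are given by positions; this links the recursive predicate to them.\<close>

lemma descents_to_minima_nth:
  "descents_to_minima w \<longleftrightarrow>
     (\<forall>i j. Suc i \<le> j \<and> j < length w \<and> w ! Suc i < w ! i \<longrightarrow> w ! Suc i \<le> w ! j)"
proof (induction w)
  case Nil
  then show ?case by simp
next
  case (Cons x w)
  \<comment> \<open>The condition for the descent at position 0 is separated from those at later positions.\<close>
  have head: "(w = [] \<or> x \<le> hd w \<or> (\<forall>z\<in>set (tl w). hd w \<le> z)) \<longleftrightarrow>
     (\<forall>j. Suc 0 \<le> j \<and> j < length (x # w) \<and> (x # w) ! Suc 0 < (x # w) ! 0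
        \<longrightarrow> (x # w) ! Suc 0 \<le> (x # w) ! j)"
  proof (cases w)
    case Nil
    then show ?thesis by simp
  next
    case (Cons y s)
    have "(\<forall>z\<in>set s. y \<le> z) \<longleftrightarrow> (\<forall>j<length w. y \<le> w ! j)"
      unfolding all_set_conv_all_nth Cons by (auto simp: nth_Cons split: nat.split)
    also have "\<dots> \<longleftrightarrow> (\<forall>j. Suc 0 \<le> j \<and> j < length (x # w) \<longrightarrow> y \<le> (x # w) ! j)"
      by (metis Suc_le_D Suc_le_mono Suc_less_eq length_Cons nth_Cons_Suc zero_le)
    finally show ?thesis using Cons by auto
  qed
  have shift: "(\<forall>j. Suc m \<le> j \<longrightarrow> Q j) \<longleftrightarrow> (\<forall>j. m \<le> j \<longrightarrow> Q (Suc j))" for m Q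
    by (metis Suc_le_D Suc_le_mono)
  have split: "(\<forall>i. Q i) \<longleftrightarrow> Q 0 \<and> (\<forall>i. Q (Suc i))" for Q :: "nat \<Rightarrow> bool"
    by (metis not0_implies_Suc)
  have rest: "descents_to_minima w \<longleftrightarrow>
     (\<forall>i j. Suc (Suc i) \<le> j \<and> j < length (x # w) \<and> (x # w) ! Suc (Suc i) < (x # w) ! Suc i
        \<longrightarrow> (x # w) ! Suc (Suc i) \<le> (x # w) ! j)"
    unfolding Cons.IH imp_conjL shift by simp
  show ?case
    unfolding descents_to_minima_Cons head rest
    using split[of "\<lambda>i. \<forall>j. Suc i \<le> j \<and> j < length (x # w) \<and> (x # w) ! Suc i < (x # w) ! i
        \<longrightarrow> (x # w) ! Suc i \<le> (x # w) ! j"] by argo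
qed

lemma weakly_ascending_between_mono:
  assumes "weakly_ascending_between w i j" "i \<le> l" "l \<le> j"
  shows "w ! l \<le> w ! j"
proof -
  have "l \<le> j \<Longrightarrow> w ! l \<le> w ! j"
    using assms(3)
  proof (induction l rule: inc_induct)
    case base
    then show ?case by simp
  next
    case (step m)
    then show ?case
      using assms by (auto simp: weakly_ascending_between_def intro: order_trans)
  qed
  then show ?thesis using assms(3) .
qed

text \<open>A run can be prolonged to the left unless it starts the word or follows a descent; from such a
  position, the longest weakly ascending stretch to the right is a run.\<close>

lemma weak_ascent_run_starts:
  "(\<exists>j. weak_ascent_run w i j) \<longleftrightarrow> i < length w \<and> (i = 0 \<or> w ! i < w ! (i - 1))"
proof (intro iffI conjI)
  assume "\<exists>j. weak_ascent_run w i j"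
  then obtain j where run: "weak_ascent_run w i j" by blast
  then have asc: "weakly_ascending_between w i j"
    by (simp add: weak_ascent_run_def)
  then show "i < length w"
    by (auto simp: weakly_ascending_between_def)
  show "i = 0 \<or> w ! i < w ! (i - 1)"
  proof (rule ccontr)
    assume "\<not> (i = 0 \<or> w ! i < w ! (i - 1))"
    then have "i \<noteq> 0" "\<not> w ! i < w ! (i - 1)" by auto
    have "w ! l \<le> w ! (l + 1)" if "i - 1 \<le> l" "l < j" for l
    proof (cases "i \<le> l")
      case True
      then show ?thesis using asc that by (simp add: weakly_ascending_between_def)
    next
      case False
      then have "l = i - 1" "l + 1 = i" using that \<open>i \<noteq> 0\<close> by auto
      then show ?thesis using \<open>\<not> w ! i < w ! (i - 1)\<close> by simp
    qed
    then have "weakly_ascending_between w (i - 1) j"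
      using asc by (auto simp: weakly_ascending_between_def)
    then have "i - 1 = i"
      using run unfolding weak_ascent_run_def by (metis diff_le_self order_refl)
    then show False using \<open>i \<noteq> 0\<close> by simp
  qed
next
  assume "i < length w \<and> (i = 0 \<or> w ! i < w ! (i - 1))"
  then have i: "i < length w" and start: "i = 0 \<or> w ! i < w ! (i - 1)" by auto
  define j where "j = (GREATEST j. weakly_ascending_between w i j)"
  have bound: "\<And>j. weakly_ascending_between w i j \<Longrightarrow> j \<le> length w"
    by (simp add: weakly_ascending_between_def)
  have "weakly_ascending_between w i i"
    using i by (simp add: weakly_ascending_between_def)
  then have asc: "weakly_ascending_between w i j"
    unfolding j_def using bound by (rule GreatestI_nat)
  have "i' = i \<and> j' = j" if le: "i' \<le> i" "j \<le> j'" and asc': "weakly_ascending_between w i' j'" for i' j'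
  proof -
    have "i' = i"
    proof (rule ccontr)
      assume "i' \<noteq> i"
      then have "i' \<le> i - 1" "i - 1 < j'" "i \<noteq> 0"
        using le asc by (auto simp: weakly_ascending_between_def)
      then have "w ! (i - 1) \<le> w ! (i - 1 + 1)"
        using asc' unfolding weakly_ascending_between_def by blast
      then show False
        using start \<open>i \<noteq> 0\<close> by simp
    qed
    moreover from this have "j' \<le> j"
      unfolding j_def using asc' bound Greatest_le_nat by blast
    ultimately show ?thesis using le by simp
  qed
  then show "\<exists>j. weak_ascent_run w i j"
    using asc unfolding weak_ascent_run_def by blast
qed

text \<open>A run start is below any later letter because it is below the leading term of the run that contains
  that letter, and the leading term is the least letter of its run.\<close>

lemma weakly_flattened_iff_starts_minimal:
  "weakly_flattened w \<longleftrightarrow>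
     (\<forall>i j. i \<le> j \<and> j < length w \<and> (i = 0 \<or> w ! i < w ! (i - 1)) \<longrightarrow> w ! i \<le> w ! j)"
proof
  assume flat: "weakly_flattened w"
  show "\<forall>i j. i \<le> j \<and> j < length w \<and> (i = 0 \<or> w ! i < w ! (i - 1)) \<longrightarrow> w ! i \<le> w ! j"
  proof (intro allI impI)
    fix i j
    assume *: "i \<le> j \<and> j < length w \<and> (i = 0 \<or> w ! i < w ! (i - 1))"
    \<comment> \<open>\<open>s\<close> is the first position of the run that contains position \<open>j\<close>.\<close>
    define start where "start = (\<lambda>s. s \<le> j \<and> (s = 0 \<or> w ! s < w ! (s - 1)))"
    define s where "s = (GREATEST s. start s)"
    have bound: "\<And>s. start s \<Longrightarrow> s \<le> j"
      by (simp add: start_def)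
    have "start i"
      using * by (simp add: start_def)
    then have s: "start s" and "i \<le> s"
      unfolding s_def using bound GreatestI_nat Greatest_le_nat by blast+
    have "\<not> start (Suc l)" if "s \<le> l" for l
      using Greatest_le_nat[of start "Suc l" j] bound that unfolding s_def[symmetric] by fastforce
    then have "weakly_ascending_between w s j"
      using * s by (auto simp: weakly_ascending_between_def start_def not_less)
    then have "w ! s \<le> w ! j"
      using weakly_ascending_between_mono s start_def by blast
    moreover have "w ! i \<le> w ! s"
    proof -
      obtain e e' where "weak_ascent_run w i e" "weak_ascent_run w s e'"
        using weak_ascent_run_starts[of w i] weak_ascent_run_starts[of w s] * s
        by (auto simp: start_def)
      then show ?thesis
        using flat \<open>i \<le> s\<close> unfolding weakly_flattened_def by blast
    qed
    ultimately show "w ! i \<le> w ! j" by simp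
  qed
next
  assume *: "\<forall>i j. i \<le> j \<and> j < length w \<and> (i = 0 \<or> w ! i < w ! (i - 1)) \<longrightarrow> w ! i \<le> w ! j"
  show "weakly_flattened w"
    unfolding weakly_flattened_def
  proof (intro allI impI)
    fix i j i' j'
    assume "weak_ascent_run w i j \<and> weak_ascent_run w i' j' \<and> i \<le> i'"
    then show "w ! i \<le> w ! i'"
      using * weak_ascent_run_starts by blast
  qed
qed

lemma weakly_flattened_Cons:
  "weakly_flattened (x # w) \<longleftrightarrow> (\<forall>z\<in>set w. x \<le> z) \<and> descents_to_minima w"
proof -
  have "weakly_flattened (x # w) \<longleftrightarrow> (\<forall>j<length (x # w). (x # w) ! 0 \<le> (x # w) ! j)
      \<and> descents_to_minima (x # w)"
  proof -
    have split: "(\<forall>i. Q i) \<longleftrightarrow> Q 0 \<and> (\<forall>i. Q (Suc i))" for Q :: "nat \<Rightarrow> bool"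
      by (metis not0_implies_Suc)
    show ?thesis
      unfolding weakly_flattened_iff_starts_minimal descents_to_minima_nth
      by (subst split) simp
  qed
  also have "(\<forall>j<length (x # w). (x # w) ! 0 \<le> (x # w) ! j) \<longleftrightarrow> (\<forall>z\<in>set (x # w). x \<le> z)"
    unfolding all_set_conv_all_nth by simp
  finally show ?thesis
    by (auto simp: descents_to_minima_Cons)
qed

section \<open>Inserting copies of a largest letter\<close>

text \<open>The words obtained from \<open>w\<close> by inserting \<open>t\<close> copies of \<open>c\<close>, described through the deletion of
  all \<open>c\<close>, and restricted to those whose descent bottoms are right-to-left minima.\<close>

definition insertions :: "'a::linorder \<Rightarrow> nat \<Rightarrow> 'a list \<Rightarrow> 'a list set" where
  "insertions c t w = {u. filter (\<lambda>x. x \<noteq> c) u = w \<and> count_list u c = t \<and> descents_to_minima u}"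

lemma set_filter_noteq: "filter (\<lambda>x. x \<noteq> c) u = w \<Longrightarrow> set u \<subseteq> insert c (set w)"
  by auto

text \<open>The last of the initial copies of \<open>c\<close> is followed by \<open>x\<close>, and this is a descent.\<close>

lemma first_minimal_if_largest_precedes:
  assumes "filter (\<lambda>x. x \<noteq> c) u = x # w" "\<forall>z\<in>set (x # w). z < c"
    and "descents_to_minima (c # u)"
  shows "\<forall>z\<in>set w. x \<le> z"
  using assms
proof (induction u)
  case Nil
  then show ?case by simp
next
  case (Cons y u)
  show ?case
  proof (cases "y = c")
    case True
    then show ?thesis using Cons by (simp add: descents_to_minima_Cons)
  next
    case False
    then have "y = x" "filter (\<lambda>x. x \<noteq> c) u = w" using Cons.prems by auto
    then show ?thesis using Cons.prems by (auto simp: descents_to_minima_Cons)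
  qed
qed

text \<open>Deleting the largest letter can only create a new adjacency where copies of \<open>c\<close> stood; the
  letter after such a block was already a descent bottom, hence a right-to-left minimum.\<close>

lemma descents_to_minima_filter_largest:
  assumes "descents_to_minima u" "\<forall>z\<in>set u. z \<le> c"
  shows "descents_to_minima (filter (\<lambda>x. x \<noteq> c) u)"
  using assms
proof (induction u)
  case Nil
  then show ?case by simp
next
  case (Cons x u)
  define w where "w = filter (\<lambda>x. x \<noteq> c) u"
  have w: "descents_to_minima w"
    using Cons by (auto simp: descents_to_minima_Cons w_def)
  show ?case
  proof (cases "x = c \<or> w = []")
    case True
    then show ?thesis using w by (auto simp: w_def descents_to_minima_Cons)
  next
    case False
    then obtain y s where ys: "w = y # s" by (cases w) auto
    then obtain z u' where u: "u = z # u'" by (cases u) (auto simp: w_def)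
    have "x \<le> y \<or> (\<forall>z\<in>set s. y \<le> z)"
    proof (cases "z = c")
      case True
      have "\<forall>z\<in>set s. y \<le> z"
      proof (rule first_minimal_if_largest_precedes)
        show "filter (\<lambda>x. x \<noteq> c) u' = y # s"
          using True u w_def ys by simp
        then have "set (y # s) \<subseteq> {z \<in> set u'. z \<noteq> c}"
          by (metis order_refl set_filter)
        then show "\<forall>z\<in>set (y # s). z < c"
          using Cons.prems u by fastforce
        show "descents_to_minima (c # u')"
          using Cons.prems u True by simp
      qed
      then show ?thesis by simp
    next
      case False
      then show ?thesis using Cons.prems u ys by (auto simp: w_def)
    qed
    then show ?thesis
      using False w ys by (simp add: w_def descents_to_minima_Cons)
  qed
qed

lemma insertions_Nil: "insertions c t [] = {replicate t c}"
proof -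
  have "descents_to_minima (replicate t c)" for t
    by (induction t) (auto simp: descents_to_minima_Cons)
  moreover have "u = replicate (count_list u c) c" if "\<forall>x\<in>set u. x = c" for u
    using that by (induction u) auto
  moreover have "count_list (replicate t c) c = t"
    by (induction t) auto
  ultimately show ?thesis
    unfolding insertions_def filter_empty_conv by (intro set_eqI) (simp, metis in_set_replicate)
qed

text \<open>A word is classified by its first letter: it is \<open>x\<close>, or an inserted \<open>c\<close>, which must lie in the gap
  before \<open>x\<close> and so forces \<open>x\<close> to be a right-to-left minimum. This recursion becomes Pascal's rule
  in the count.\<close>

lemma insertions_Cons:
  assumes less: "\<forall>z\<in>set (x # w). z < c" and desc: "descents_to_minima (x # w)"
  shows "insertions c t (x # w) = Cons x ` insertions c t w \<union>
    (if t > 0 \<and> (\<forall>z\<in>set w. x \<le> z) then Cons c ` insertions c (t - 1) (x # w) else {})"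
    (is "_ = ?R")
proof (intro set_eqI iffI)
  fix u
  assume u: "u \<in> insertions c t (x # w)"
  then obtain y u' where y: "u = y # u'" by (cases u) (auto simp: insertions_def)
  show "u \<in> ?R"
  proof (cases "y = c")
    case True
    then have "\<forall>z\<in>set w. x \<le> z"
      using u less first_minimal_if_largest_precedes[of c u' x w] y by (auto simp: insertions_def)
    then show ?thesis
      using u y True by (auto simp: insertions_def descents_to_minima_Cons)
  next
    case False
    then show ?thesis
      using u y by (auto simp: insertions_def descents_to_minima_Cons)
  qed
next
  fix u
  assume "u \<in> ?R"
  then consider u' where "u = x # u'" "u' \<in> insertions c t w"
    | u' where "u = c # u'" "u' \<in> insertions c (t - 1) (x # w)" "t > 0" "\<forall>z\<in>set w. x \<le> z"
    by (cases "t > 0 \<and> (\<forall>z\<in>set w. x \<le> z)") auto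
  then show "u \<in> insertions c t (x # w)"
  proof cases
    case 1
    have "u' = [] \<or> x \<le> hd u' \<or> (\<forall>z\<in>set (tl u'). hd u' \<le> z)"
    proof (cases u')
      case (Cons y s)
      show ?thesis
      proof (cases "y = c")
        case True
        then show ?thesis using less Cons by auto
      next
        case False
        then have w: "w = y # filter (\<lambda>x. x \<noteq> c) s"
          using 1 Cons by (auto simp: insertions_def)
        have "\<forall>z\<in>set s. y \<le> z" if "\<forall>z\<in>set (filter (\<lambda>x. x \<noteq> c) s). y \<le> z"
        proof
          fix z assume "z \<in> set s"
          moreover have "y < c" using less w by simp
          ultimately show "y \<le> z" using that by (cases "z = c") auto
        qed
        then show ?thesis
          using desc w Cons by auto
      qed
    qed simp
    then show ?thesis
      using 1 less by (auto simp: insertions_def descents_to_minima_Cons)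
  next
    case 2
    have sub: "set u' \<subseteq> insert c (set (x # w))"
      using 2(2) set_filter_noteq[of c u' "x # w"] by (simp add: insertions_def)
    have "u' = [] \<or> c \<le> hd u' \<or> (\<forall>z\<in>set (tl u'). hd u' \<le> z)"
    proof (cases u')
      case (Cons y s)
      show ?thesis
      proof (cases "y = c")
        case False
        then have "y = x" using 2 Cons by (auto simp: insertions_def)
        have "x \<le> z" if "z \<in> set s" for z
        proof -
          have "z = c \<or> z = x \<or> z \<in> set w" using that sub Cons by auto
          then show ?thesis using 2(4) less by auto
        qed
        then show ?thesis using Cons \<open>y = x\<close> by simp
      qed (simp add: Cons)
    qed simp
    then show ?thesis
      using 2 by (auto simp: insertions_def descents_to_minima_Cons)
  qed
qed


lemma rl_minima_replicate: "rl_minima (replicate t c) = t"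
  by (induction t) auto

text \<open>A positive number of letters cannot be distributed over zero gaps.\<close>

lemma gbinomial_no_gaps: "m > 0 \<Longrightarrow> (real m - 1) gchoose m = 0"
  using binomial_gbinomial[of "m - 1" m, where 'a = real]
  by (simp add: of_nat_diff binomial_eq_0)

text \<open>The later steps of the count depend on a word only through its number of right-to-left minima.
  Summing an arbitrary function \<open>f\<close> of this number records the distribution of the number over all
  insertions, and lets the statement be iterated.\<close>

lemma sum_insertions:
  fixes f :: "nat \<Rightarrow> real"
  assumes "\<forall>z\<in>set w. z < c" "descents_to_minima w"
  shows "finite (insertions c t w) \<and>
    (\<Sum>u\<in>insertions c t w. f (rl_minima u)) =
    (\<Sum>j=0..t. ((real (rl_minima w) + real (t - j) - 1) gchoose (t - j)) * f (rl_minima w + j))"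
  using assms
proof (induction w arbitrary: t f)
  case Nil
  have "(\<Sum>j=0..t. ((real (t - j) - 1) gchoose (t - j)) * f j) =
      (\<Sum>j\<in>{t}. ((real (t - j) - 1) gchoose (t - j)) * f j)"
    by (rule sum.mono_neutral_right) (use gbinomial_no_gaps in \<open>auto simp del: of_nat_diff\<close>)
  then show ?case
    by (simp add: insertions_Nil rl_minima_replicate)
next
  case (Cons x w)
  have less: "\<forall>z\<in>set (x # w). z < c" and desc: "descents_to_minima (x # w)"
    using Cons.prems by auto
  then have w: "\<forall>z\<in>set w. z < c" "descents_to_minima w"
    by (auto simp: descents_to_minima_Cons)
  note IH = Cons.IH[OF w]
  have bounds: "set u \<subseteq> insert c (set v)" "set v \<subseteq> set u" if "u \<in> insertions c t v" for u t v
    using that by (auto simp: insertions_def)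
  \<comment> \<open>Since \<open>x < c\<close>, inserted copies of \<open>c\<close> do not change whether \<open>x\<close> is a minimum.\<close>
  have keep: "rl_minima (x # u) = (if \<forall>z\<in>set w. x \<le> z then Suc (rl_minima u) else rl_minima u)"
    if "u \<in> insertions c t w" for u t
  proof -
    have "(\<forall>z\<in>set u. x \<le> z) \<longleftrightarrow> (\<forall>z\<in>set w. x \<le> z)"
      using bounds[OF that] less by (auto dest: order.strict_implies_order)
    then show ?thesis by simp
  qed
  \<comment> \<open>The smaller letter \<open>x\<close> follows, so this copy of \<open>c\<close> is no right-to-left minimum.\<close>
  have ins: "rl_minima (c # u) = rl_minima u" if "u \<in> insertions c t (x # w)" for u t
  proof -
    have "x \<in> set u" "\<not> c \<le> x"
      using bounds[OF that] less by auto
    then show ?thesis by auto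
  qed
  show ?case
  proof (cases "\<forall>z\<in>set w. x \<le> z")
    case False
    then have eq: "insertions c t (x # w) = Cons x ` insertions c t w"
      by (subst insertions_Cons[OF less desc]) (use False in auto)
    show ?thesis
      unfolding eq using IH[of t f] keep False
      by (auto simp: sum.reindex)
  next
    case True
    define g where "g = (\<lambda>R t (f::nat \<Rightarrow> real).
      \<Sum>j=0..t. ((real R + real (t - j) - 1) gchoose (t - j)) * f (R + j))"
    \<comment> \<open>The summand \<open>j = Suc t\<close>, where all copies go to the end, has no partner in \<open>g (Suc R) t f\<close>.\<close>
    have pascal: "g (Suc R) (Suc t) f = g R (Suc t) (\<lambda>i. f (Suc i)) + g (Suc R) t f" for R t f
    proof -
      have step: "(real (Suc R) + real (Suc t - j) - 1) gchoose (Suc t - j) =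
          ((real R + real (Suc t - j) - 1) gchoose (Suc t - j)) +
          ((real (Suc R) + real (t - j) - 1) gchoose (t - j))" if "j \<le> t" for j
      proof -
        have "real R + real (t - j) + 1 gchoose Suc (t - j) =
            (real R + real (t - j) gchoose Suc (t - j)) + (real R + real (t - j) gchoose (t - j))"
          using gbinomial_Suc_Suc[of "real R + real (t - j)" "t - j"] by simp
        then show ?thesis
          using that by (simp add: Suc_diff_le algebra_simps)
      qed
      have "g (Suc R) (Suc t) f =
        (\<Sum>j=0..t. ((real (Suc R) + real (Suc t - j) - 1) gchoose (Suc t - j)) * f (Suc R + j))
          + f (Suc R + Suc t)"
        by (simp only: g_def sum.atLeast0_atMost_Suc diff_self_eq_0 gbinomial_0 mult_1)
      also have "(\<Sum>j=0..t. ((real (Suc R) + real (Suc t - j) - 1) gchoose (Suc t - j)) * f (Suc R + j))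
        = (\<Sum>j=0..t. ((real R + real (Suc t - j) - 1) gchoose (Suc t - j)) * f (Suc R + j))
          + g (Suc R) t f"
        unfolding g_def sum.distrib[symmetric]
        by (rule sum.cong[OF refl]) (simp only: step atLeastAtMost_iff distrib_right)
      finally show ?thesis
        by (simp only: g_def sum.atLeast0_atMost_Suc diff_self_eq_0 gbinomial_0 mult_1
            add_Suc add_Suc_right add_ac)
    qed
    have "finite (insertions c t (x # w)) \<and>
      (\<Sum>u\<in>insertions c t (x # w). f (rl_minima u)) = g (Suc (rl_minima w)) t f"
    proof (induction t)
      case 0
      have eq: "insertions c 0 (x # w) = Cons x ` insertions c 0 w"
        by (subst insertions_Cons[OF less desc]) (use True in simp)
      show ?case
        unfolding eq using IH[of 0 "\<lambda>i. f (Suc i)"] keep True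
        by (auto simp: sum.reindex g_def)
    next
      case (Suc t)
      have eq: "insertions c (Suc t) (x # w) =
          Cons x ` insertions c (Suc t) w \<union> Cons c ` insertions c t (x # w)"
        by (subst insertions_Cons[OF less desc]) (use True in simp)
      have fin: "finite (insertions c (Suc t) w)" "finite (insertions c t (x # w))"
        using IH Suc by auto
      have "(\<Sum>u\<in>insertions c (Suc t) (x # w). f (rl_minima u)) =
          (\<Sum>u\<in>Cons x ` insertions c (Suc t) w. f (rl_minima u)) +
          (\<Sum>u\<in>Cons c ` insertions c t (x # w). f (rl_minima u))"
        unfolding eq by (rule sum.union_disjoint) (use fin less in auto)
      also have "(\<Sum>u\<in>Cons x ` insertions c (Suc t) w. f (rl_minima u)) =
          g (rl_minima w) (Suc t) (\<lambda>i. f (Suc i))"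
        using IH[of "Suc t" "\<lambda>i. f (Suc i)"] keep True
        by (simp add: sum.reindex g_def del: rl_minima.simps)
      also have "(\<Sum>u\<in>Cons c ` insertions c t (x # w). f (rl_minima u)) = g (Suc (rl_minima w)) t f"
        using Suc ins by (simp add: sum.reindex del: rl_minima.simps)
      finally show ?case
        using fin eq by (simp add: pascal)
    qed
    then show ?thesis
      using True by (simp add: g_def)
  qed
qed

section \<open>Words with prescribed letter multiplicities\<close>

text \<open>The letters are \<open>v 1, \<dots>, v k\<close>. Keeping them abstract lets the block ranks of a Fubini ranking
  be used directly, without a relabelling of words.\<close>

definition words_with :: "(nat \<Rightarrow> 'a::linorder) \<Rightarrow> (nat \<Rightarrow> nat) \<Rightarrow> nat \<Rightarrow> 'a list set" where
  "words_with v b k = {u. set u \<subseteq> v ` {1..k} \<and> (\<forall>i\<in>{1..k}. count_list u (v i) = b i)}"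

lemma count_list_filter: "count_list (filter P u) x = (if P x then count_list u x else 0)"
  by (induction u) auto

text \<open>Deleting the largest letter splits the words into classes, one for each word in the
  remaining letters.\<close>

lemma words_with_Suc:
  fixes v :: "nat \<Rightarrow> 'a::linorder"
  assumes mono: "strict_mono_on {1..Suc k} v"
  shows "{u \<in> words_with v b (Suc k). descents_to_minima u} =
    (\<Union>w\<in>{w \<in> words_with v b k. descents_to_minima w}. insertions (v (Suc k)) (b (Suc k)) w)"
proof -
  have less: "v i < v (Suc k)" if "i \<in> {1..k}" for i
    using strict_mono_onD[OF mono, of i "Suc k"] that by auto
  have range: "v ` {1..Suc k} = insert (v (Suc k)) (v ` {1..k})"
    by (simp add: atLeastAtMostSuc_conv)
  have ball: "(\<forall>i\<in>{1..Suc k}. Q i) \<longleftrightarrow> Q (Suc k) \<and> (\<forall>i\<in>{1..k}. Q i)" for Q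
    by (simp add: atLeastAtMostSuc_conv)
  show ?thesis
  proof (intro set_eqI iffI)
    fix u
    assume u: "u \<in> {u \<in> words_with v b (Suc k). descents_to_minima u}"
    define w where "w = filter (\<lambda>x. x \<noteq> v (Suc k)) u"
    have "set u \<subseteq> insert (v (Suc k)) (v ` {1..k})"
      using u range by (simp add: words_with_def)
    then have "set w \<subseteq> v ` {1..k}"
      unfolding w_def by auto
    moreover have "\<forall>z\<in>set u. z \<le> v (Suc k)"
    proof
      fix z
      assume "z \<in> set u"
      then have "z = v (Suc k) \<or> (\<exists>i\<in>{1..k}. z = v i)"
        using \<open>set u \<subseteq> insert (v (Suc k)) (v ` {1..k})\<close> by blast
      then show "z \<le> v (Suc k)"
        using less less_imp_le by blast
    qed
    moreover have "count_list w (v i) = b i" if "i \<in> {1..k}" for i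
      using u less_imp_neq[OF less[OF that]] that by (simp add: w_def count_list_filter words_with_def)
    moreover have "descents_to_minima w"
      unfolding w_def using u calculation(2) by (intro descents_to_minima_filter_largest) simp_all
    moreover have "u \<in> insertions (v (Suc k)) (b (Suc k)) w"
      using u ball by (simp add: insertions_def w_def words_with_def)
    ultimately show "u \<in> (\<Union>w\<in>{w \<in> words_with v b k. descents_to_minima w}.
        insertions (v (Suc k)) (b (Suc k)) w)"
      unfolding words_with_def by blast
  next
    fix u
    assume "u \<in> (\<Union>w\<in>{w \<in> words_with v b k. descents_to_minima w}.
        insertions (v (Suc k)) (b (Suc k)) w)"
    then obtain w where w: "w \<in> words_with v b k" "u \<in> insertions (v (Suc k)) (b (Suc k)) w"
      by blast
    then have "set u \<subseteq> insert (v (Suc k)) (set w)"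
      using set_filter_noteq[of "v (Suc k)" u w] by (simp add: insertions_def)
    then have "set u \<subseteq> v ` {1..Suc k}"
      unfolding range using w by (auto simp: words_with_def)
    moreover have "count_list u (v i) = b i" if "i \<in> {1..k}" for i
    proof -
      have "count_list w (v i) = count_list u (v i)"
        using w(2) less_imp_neq[OF less[OF that]] by (auto simp: insertions_def count_list_filter)
      then show ?thesis using w that by (simp add: words_with_def)
    qed
    ultimately show "u \<in> {u \<in> words_with v b (Suc k). descents_to_minima u}"
      using w(2) unfolding words_with_def insertions_def mem_Collect_eq ball by simp
  qed
qed

lemma words_with_1: "words_with v b 1 = {replicate (b 1) (v 1)}"
proof (intro set_eqI iffI)
  fix u
  assume "u \<in> words_with v b 1"
  then have "set u \<subseteq> {v 1}" "count_list u (v 1) = b 1"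
    by (simp_all add: words_with_def)
  moreover have "u = replicate (count_list u (v 1)) (v 1)" if "set u \<subseteq> {v 1}" for u
    using that by (induction u) auto
  ultimately show "u \<in> {replicate (b 1) (v 1)}"
    by (metis singletonI)
next
  fix u
  assume "u \<in> {replicate (b 1) (v 1)}"
  moreover have "count_list (replicate t (v 1)) (v 1) = t" for t
    by (induction t) auto
  ultimately show "u \<in> words_with v b 1"
    by (auto simp: words_with_def)
qed

text \<open>Induction on the number of letters. The induction step applies the hypothesis to the function that
  \<open>sum_insertions\<close> assigns to \<open>f\<close>. Here \<open>b 1 + (\<Sum>r=2..k. j r)\<close> is the number of
  right-to-left minima: all copies of the least letter, and the \<open>j r\<close> copies of \<open>v r\<close> that come after
  all smaller letters.\<close>

lemma sum_words_with:
  fixes v :: "nat \<Rightarrow> 'a::linorder" and f :: "nat \<Rightarrow> real"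
  assumes "k \<ge> 1" "strict_mono_on {1..k} v"
  shows "finite {u \<in> words_with v b k. descents_to_minima u} \<and>
    (\<Sum>u | u \<in> words_with v b k \<and> descents_to_minima u. f (rl_minima u)) =
    (\<Sum>j \<in> (\<Pi>\<^sub>E i\<in>{2..k}. {0..b i}).
       (\<Prod>i=2..k. (real (b 1) + (\<Sum>r=2..i-1. real (j r)) + real (b i - j i) - 1) gchoose (b i - j i))
       * f (b 1 + (\<Sum>r=2..k. j r)))"
  using assms
proof (induction k arbitrary: f rule: nat_induct_at_least)
  case base
  have "descents_to_minima (replicate (b 1) (v 1))"
    using insertions_Nil[of "v 1" "b 1"] by (auto simp: insertions_def)
  then have "{u \<in> words_with v b 1. descents_to_minima u} = {replicate (b 1) (v 1)}"
    unfolding words_with_1 by auto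
  then show ?case
    by (simp add: rl_minima_replicate)
next
  case (Suc k)
  let ?W = "\<lambda>k. {u \<in> words_with v b k. descents_to_minima u}"
  let ?ins = "insertions (v (Suc k)) (b (Suc k))"
  let ?c = "\<lambda>j i. (real (b 1) + (\<Sum>r=2..i-1. real (j r)) + real (b i - j i) - 1) gchoose (b i - j i)"
  let ?P = "\<Pi>\<^sub>E i\<in>{2..k}. {0..b i}"
  have mono: "strict_mono_on {1..k} v"
    using Suc.prems by (auto simp: strict_mono_on_def)
  note IH = Suc.IH[OF mono]
  have desc: "descents_to_minima w" and less: "\<forall>z\<in>set w. z < v (Suc k)" if "w \<in> ?W k" for w
    using that strict_mono_onD[OF Suc.prems, of _ "Suc k"] by (fastforce simp: words_with_def)+
  note ins = sum_insertions[OF less desc]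
  define F where "F = (\<lambda>R. \<Sum>y=0..b (Suc k).
    ((real R + real (b (Suc k) - y) - 1) gchoose (b (Suc k) - y)) * f (R + y))"
  have W: "?W (Suc k) = (\<Union>w\<in>?W k. ?ins w)"
    by (rule words_with_Suc[OF Suc.prems])
  have fin: "finite (?W (Suc k))"
    unfolding W using IH ins by blast
  have inj: "inj_on (\<lambda>(y, j). j(Suc k := y)) ({0..b (Suc k)} \<times> ?P)"
    using inj_combinator[of "Suc k" "{2..k}" "\<lambda>i. {0..b i}"] by simp
  have "(\<Sum>u\<in>?W (Suc k). f (rl_minima u)) = (\<Sum>w\<in>?W k. \<Sum>u\<in>?ins w. f (rl_minima u))"
    unfolding W by (rule sum.UNION_disjoint) (use IH ins in \<open>auto simp: insertions_def\<close>)
  also have "\<dots> = (\<Sum>w\<in>?W k. F (rl_minima w))"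
    unfolding F_def by (rule sum.cong[OF refl]) (use ins in blast)
  also have "\<dots> = (\<Sum>j\<in>?P. (\<Prod>i=2..k. ?c j i) * F (b 1 + (\<Sum>r=2..k. j r)))"
    using IH by blast
  also have "\<dots> = (\<Sum>j\<in>?P. \<Sum>y=0..b (Suc k). (\<Prod>i=2..Suc k. ?c (j(Suc k := y)) i)
      * f (b 1 + (\<Sum>r=2..Suc k. (j(Suc k := y)) r)))"
  proof (rule sum.cong[OF refl])
    fix j
    have sums: "(\<Sum>r=2..m. real ((j(Suc k := y)) r)) = (\<Sum>r=2..m. real (j r))" if "m \<le> k" for m y
      using that by (intro sum.cong) auto
    have "?c (j(Suc k := y)) i = ?c j i" if "i \<in> {2..k}" for i y
    proof -
      have "i - 1 \<le> k" "i \<noteq> Suc k" using that by auto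
      then show ?thesis unfolding sums[OF \<open>i - 1 \<le> k\<close>] by simp
    qed
    then have "(\<Prod>i=2..k. ?c (j(Suc k := y)) i) = (\<Prod>i=2..k. ?c j i)" for y
      by (intro prod.cong refl)
    moreover note sums[of k]
    moreover have "(\<Sum>r=2..k. (j(Suc k := y)) r) = (\<Sum>r=2..k. j r)" for y
      by (rule sum.cong) auto
    ultimately show "(\<Prod>i=2..k. ?c j i) * F (b 1 + (\<Sum>r=2..k. j r)) =
      (\<Sum>y=0..b (Suc k). (\<Prod>i=2..Suc k. ?c (j(Suc k := y)) i)
        * f (b 1 + (\<Sum>r=2..Suc k. (j(Suc k := y)) r)))"
      using Suc.hyps unfolding F_def sum_distrib_left
      by (intro sum.cong refl) (simp add: prod.nat_ivl_Suc' sum.nat_ivl_Suc' mult_ac add_ac)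
  qed
  also have "\<dots> = (\<Sum>(y, j)\<in>{0..b (Suc k)} \<times> ?P. (\<Prod>i=2..Suc k. ?c (j(Suc k := y)) i)
      * f (b 1 + (\<Sum>r=2..Suc k. (j(Suc k := y)) r)))"
    by (subst sum.swap) (rule sum.cartesian_product)
  also have "\<dots> = (\<Sum>j\<in>(\<lambda>(y, j). j(Suc k := y)) ` ({0..b (Suc k)} \<times> ?P).
      (\<Prod>i=2..Suc k. ?c j i) * f (b 1 + (\<Sum>r=2..Suc k. j r)))"
    by (subst sum.reindex[OF inj]) (simp only: comp_def case_prod_unfold)
  also have "(\<lambda>(y, j). j(Suc k := y)) ` ({0..b (Suc k)} \<times> ?P) = (\<Pi>\<^sub>E i\<in>{2..Suc k}. {0..b i})"
    using Suc.hyps by (simp add: atLeastAtMostSuc_conv PiE_insert_eq)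
  finally show ?case
    using fin by simp
qed


section \<open>Fubini rankings with given reduced content\<close>

text \<open>The rank shared by the \<open>l\<close>-th block of tied competitors if the blocks have sizes
  \<open>a 1, a 2, \<dots>\<close> from the best block on.\<close>

definition block_rank :: "(nat \<Rightarrow> nat) \<Rightarrow> nat \<Rightarrow> nat" where
  "block_rank a l = 1 + (\<Sum>m\<in>{1..<l}. a m)"

lemma block_rank_less:
  assumes "\<forall>i\<in>{1..k}. a i \<ge> 1" "l \<in> {1..k}" "l < m"
  shows "block_rank a l < block_rank a m"
proof -
  have "block_rank a l + a l = block_rank a (Suc l)"
    using assms by (simp add: block_rank_def)
  also have "\<dots> \<le> block_rank a m"
    unfolding block_rank_def using assms by (intro add_left_mono sum_mono2) auto
  finally show ?thesis using assms by fastforce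
qed

lemma card_positions_less:
  "card {j. j < length r \<and> r ! j < x} = (\<Sum>y | y \<in> set r \<and> y < x. count_list r y)"
proof -
  have "card {j. j < length r \<and> r ! j < x} = length (filter (\<lambda>y. y < x) r)"
    by (rule length_filter_conv_card[symmetric])
  also have "\<dots> = (\<Sum>y | y \<in> set r \<and> y < x. count_list (filter (\<lambda>y. y < x) r) y)"
    by (rule sum_count_set[symmetric]) auto
  also have "\<dots> = (\<Sum>y | y \<in> set r \<and> y < x. count_list r y)"
    by (rule sum.cong) (auto simp: count_list_filter)
  finally show ?thesis .
qed

text \<open>In a Fubini ranking each rank is determined by the number of smaller entries, that is, by the sizes
  of the earlier blocks, and these sizes are what the reduced content lists.\<close>

lemma fubini_reduced_content_imp_words_with:
  assumes fub: "fubini_ranking n r" and red: "reduced_content n r = map a [1..<Suc k]"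
  shows "r \<in> words_with (block_rank a) a k"
proof -
  \<comment> \<open>The ranks that occur, in increasing order.\<close>
  define ys where "ys = filter (\<lambda>x. count_list r x \<noteq> 0) [1..<Suc n]"
  have map_ys: "map (count_list r) ys = map a [1..<Suc k]"
    using red by (simp add: reduced_content_def content_def filter_map ys_def comp_def)
  then have len: "length ys = k"
    by (metis length_map length_upt diff_Suc_1)
  have count: "count_list r (ys ! p) = a (Suc p)" if "p < k" for p
    using arg_cong[OF map_ys, of "\<lambda>xs. xs ! p"] that len by (simp del: upt_Suc)
  have set_ys: "set ys = set r"
    using fub by (auto simp: ys_def count_list_0_iff fubini_ranking_def simp del: upt_Suc)
  have sorted: "sorted_wrt (<) ys"
    unfolding ys_def by (rule sorted_wrt_filter) (rule sorted_wrt_upt)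
  have ys: "ys ! p = block_rank a (Suc p)" if p: "p < k" for p
  proof -
    have "ys ! p \<in> set r"
      using p len set_ys by (metis nth_mem)
    then obtain i where i: "i < n" "r ! i = ys ! p"
      using fub by (auto simp: in_set_conv_nth fubini_ranking_def)
    then have "ys ! p = 1 + card {j. j < length r \<and> r ! j < ys ! p}"
      using fub by (auto simp: fubini_ranking_def)
    also have "card {j. j < length r \<and> r ! j < ys ! p} = (\<Sum>y | y \<in> set ys \<and> y < ys ! p. count_list r y)"
      by (simp add: card_positions_less set_ys)
    also have "{y. y \<in> set ys \<and> y < ys ! p} = (!) ys ` {..<p}"
    proof (intro set_eqI iffI)
      fix y
      assume "y \<in> {y. y \<in> set ys \<and> y < ys ! p}"
      then obtain q where "q < k" "y = ys ! q" "ys ! q < ys ! p"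
        using len by (auto simp: in_set_conv_nth)
      then show "y \<in> (!) ys ` {..<p}"
        using sorted_wrt_nth_less[OF sorted, of p q] len
        by (metis imageI lessThan_iff less_asym less_irrefl linorder_neqE_nat)
    next
      fix y
      assume "y \<in> (!) ys ` {..<p}"
      then show "y \<in> {y. y \<in> set ys \<and> y < ys ! p}"
        using sorted_wrt_nth_less[OF sorted] len p by auto
    qed
    also have "(\<Sum>y\<in>(!) ys ` {..<p}. count_list r y) = (\<Sum>q<p. count_list r (ys ! q))"
    proof (subst sum.reindex)
      show "inj_on ((!) ys) {..<p}"
        using sorted len p by (auto intro!: inj_on_nth simp: strict_sorted_iff)
    qed simp
    also have "\<dots> = (\<Sum>q<p. a (Suc q))"
      using count p by simp
    also have "\<dots> = (\<Sum>m\<in>{1..<Suc p}. a m)"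
      by (simp add: sum.shift_bounds_Suc_ivl lessThan_atLeast0 del: sum.op_ivl_Suc)
    finally show ?thesis by (simp add: block_rank_def)
  qed
  have "set r \<subseteq> block_rank a ` {1..k}"
  proof
    fix x
    assume "x \<in> set r"
    then obtain p where "p < k" "x = ys ! p"
      using set_ys len by (metis in_set_conv_nth)
    then show "x \<in> block_rank a ` {1..k}"
      using ys by (intro image_eqI[of _ _ "Suc p"]) auto
  qed
  moreover have "count_list r (block_rank a i) = a i" if "i \<in> {1..k}" for i
    using count[of "i - 1"] ys[of "i - 1"] that by auto
  ultimately show ?thesis
    by (simp add: words_with_def)
qed

text \<open>Since block ranks increase strictly, the entries below the \<open>l\<close>-th one are those of the first
  \<open>l - 1\<close> blocks, and listing the ranks in increasing order lists the blocks in order.\<close>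

lemma words_with_imp_fubini_reduced_content:
  assumes pos: "\<forall>i\<in>{1..k}. a i \<ge> 1" and n: "n = (\<Sum>i=1..k. a i)"
    and r: "r \<in> words_with (block_rank a) a k"
  shows "fubini_ranking n r" "reduced_content n r = map a [1..<Suc k]"
proof -
  note less = block_rank_less[OF pos]
  have inj: "inj_on (block_rank a) {1..k}"
    by (rule strict_mono_on_imp_inj_on[OF strict_mono_onI]) (rule less)
  have count: "count_list r (block_rank a i) = a i" if "i \<in> {1..k}" for i
    using r that by (simp add: words_with_def)
  have "block_rank a ` {1..k} \<subseteq> set r"
  proof
    fix x
    assume "x \<in> block_rank a ` {1..k}"
    then have "count_list r x \<noteq> 0"
      using count pos by fastforce
    then show "x \<in> set r"
      by (simp add: count_list_0_iff)
  qed
  then have set_r: "set r = block_rank a ` {1..k}"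
    using r by (auto simp: words_with_def)
  have "length r = (\<Sum>y\<in>set r. count_list r y)"
    by (rule sum_count_set[symmetric]) auto
  also have "\<dots> = n"
    unfolding set_r n using inj count by (simp add: sum.reindex)
  finally have len: "length r = n" .
  have range: "block_rank a l \<in> {1..n}" if "l \<in> {1..k}" for l
  proof -
    have "(\<Sum>m\<in>{1..<l}. a m) + a l = (\<Sum>m\<in>{1..<Suc l}. a m)"
      using that by simp
    also have "\<dots> \<le> n"
      unfolding n using that by (intro sum_mono2) auto
    finally show ?thesis
      using pos that by (fastforce simp: block_rank_def)
  qed
  have rank: "block_rank a l = 1 + card {j. j < length r \<and> r ! j < block_rank a l}" if l: "l \<in> {1..k}" for l
  proof -
    have "{y. y \<in> set r \<and> y < block_rank a l} = block_rank a ` {1..<l}"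
    proof (intro set_eqI iffI)
      fix y
      assume "y \<in> {y. y \<in> set r \<and> y < block_rank a l}"
      then obtain m where m: "m \<in> {1..k}" "y = block_rank a m" "block_rank a m < block_rank a l"
        using set_r by auto
      then have "m < l"
        using less[OF l, of m] by (metis less_asym less_irrefl linorder_neqE_nat)
      then show "y \<in> block_rank a ` {1..<l}" using m by auto
    next
      fix y
      assume "y \<in> block_rank a ` {1..<l}"
      then show "y \<in> {y. y \<in> set r \<and> y < block_rank a l}"
        using less l unfolding set_r by fastforce
    qed
    moreover have "(\<Sum>y\<in>block_rank a ` {1..<l}. count_list r y) = (\<Sum>m\<in>{1..<l}. a m)"
      using l count by (subst sum.reindex) (auto intro: inj_on_subset[OF inj])
    ultimately show ?thesis
      unfolding card_positions_less by (simp add: block_rank_def)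
  qed
  show "fubini_ranking n r"
    unfolding fubini_ranking_def
  proof (intro conjI allI impI)
    show "length r = n" by (rule len)
    show "set r \<subseteq> {1..n}" using range set_r by auto
    fix i
    assume "i < n"
    then obtain l where "l \<in> {1..k}" "r ! i = block_rank a l"
      using set_r len by (metis imageE nth_mem)
    then show "r ! i = 1 + card {j. j < n \<and> r ! j < r ! i}"
      using rank len by simp
  qed
  have "filter (\<lambda>x. count_list r x \<noteq> 0) [1..<Suc n] = map (block_rank a) [1..<Suc k]"
  proof (rule sorted_distinct_set_unique)
    show "sorted (filter (\<lambda>x. count_list r x \<noteq> 0) [1..<Suc n])"
      by (rule sorted_wrt_filter) (rule sorted_upt)
    show "distinct (filter (\<lambda>x. count_list r x \<noteq> 0) [1..<Suc n])"
      by (simp del: upt_Suc)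
    show "sorted (map (block_rank a) [1..<Suc k])"
      unfolding sorted_map
      by (rule sorted_wrt_mono_rel[OF _ sorted_wrt_upt])
        (use less in \<open>auto simp: less_imp_le simp del: upt_Suc\<close>)
    show "distinct (map (block_rank a) [1..<Suc k])"
      using inj by (simp add: distinct_map atLeastLessThanSuc_atLeastAtMost del: upt_Suc)
    show "set (filter (\<lambda>x. count_list r x \<noteq> 0) [1..<Suc n]) = set (map (block_rank a) [1..<Suc k])"
      using range set_r
      by (auto simp: count_list_0_iff atLeastLessThanSuc_atLeastAtMost simp del: upt_Suc)
  qed
  then show "reduced_content n r = map a [1..<Suc k]"
    using count by (simp add: reduced_content_def content_def filter_map comp_def del: upt_Suc)
qed

section \<open>The count\<close>

theorem theorem3p6:
  fixes a :: "nat \<Rightarrow> nat" and k n :: nat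
  assumes "k \<ge> 1"
    and "\<forall>i\<in>{1..k}. a i \<ge> 1"
    and "n = (\<Sum>i=1..k. a i)"
  shows "real (card {r. fubini_ranking n r \<and> weakly_flattened r \<and>
                       reduced_content n r = map a [1..<Suc k]}) =
         (\<Sum>j \<in> (\<Pi>\<^sub>E i\<in>{2..k}. {0..a i}).
            \<Prod>i=2..k. (real (a 1) + (\<Sum>r=2..i-1. real (j r)) + real (a i) - real (j i) - 2)
                        gchoose (a i - j i))"
proof -
  let ?v = "block_rank a"
  \<comment> \<open>A weakly flattened ranking starts with its least letter; one copy of it is split off.\<close>
  define b where "b = a(1 := a 1 - 1)"
  have a1: "a 1 \<ge> 1" and k1: "1 \<in> {1..k}"
    using assms by auto
  note less = block_rank_less[OF assms(2)]
  have mono: "strict_mono_on {1..k} ?v"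
    by (rule strict_mono_onI) (rule less)
  have neq: "?v i \<noteq> ?v 1" if "i \<in> {1..k}" "i \<noteq> 1" for i
    using less[OF k1, of i] that by auto
  let ?R = "{r. fubini_ranking n r \<and> weakly_flattened r \<and>
    reduced_content n r = map a [1..<Suc k]}"
  have "?R = {r \<in> words_with ?v a k. weakly_flattened r}"
    using fubini_reduced_content_imp_words_with words_with_imp_fubini_reduced_content[OF assms(2,3)]
    by blast
  also have "\<dots> = Cons (?v 1) ` {u \<in> words_with ?v b k. descents_to_minima u}"
  proof (intro set_eqI iffI)
    fix r
    assume r: "r \<in> {r \<in> words_with ?v a k. weakly_flattened r}"
    have "count_list r (?v 1) = a 1"
      using r k1 by (simp add: words_with_def)
    then have v1: "?v 1 \<in> set r"
      using a1 by (metis count_notin not_one_le_zero)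
    then obtain x u where xu: "r = x # u" by (cases r) auto
    have flat: "\<forall>z\<in>set u. x \<le> z" "descents_to_minima u"
      using r xu by (auto simp: weakly_flattened_Cons)
    obtain i where "i \<in> {1..k}" "x = ?v i"
      using r xu by (auto simp: words_with_def)
    then have "x = ?v 1"
      using less[OF k1, of i] flat v1 xu by (cases "i = 1") fastforce+
    then have "count_list u (?v i) = b i" if "i \<in> {1..k}" for i
    proof -
      have "count_list r (?v i) = a i"
        using r that by (simp add: words_with_def)
      then show ?thesis
        using neq[OF that] xu \<open>x = ?v 1\<close> by (cases "i = 1") (auto simp: b_def)
    qed
    moreover have "set u \<subseteq> ?v ` {1..k}"
      using r xu by (simp add: words_with_def)
    ultimately have "u \<in> words_with ?v b k"
      by (simp add: words_with_def)
    then show "r \<in> Cons (?v 1) ` {u \<in> words_with ?v b k. descents_to_minima u}"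
      using xu flat \<open>x = ?v 1\<close> by blast
  next
    fix r
    assume "r \<in> Cons (?v 1) ` {u \<in> words_with ?v b k. descents_to_minima u}"
    then obtain u where u: "r = ?v 1 # u" "u \<in> words_with ?v b k" "descents_to_minima u"
      by blast
    have "?v 1 \<le> z" if "z \<in> set u" for z
      using u that by (auto simp: words_with_def block_rank_def)
    then have "weakly_flattened r"
      using u by (simp add: weakly_flattened_Cons)
    moreover have "count_list r (?v i) = a i" if "i \<in> {1..k}" for i
      using u that neq[OF that] a1 by (auto simp: words_with_def b_def)
    moreover have "set r \<subseteq> ?v ` {1..k}"
      using u k1 by (auto simp: words_with_def)
    ultimately show "r \<in> {r \<in> words_with ?v a k. weakly_flattened r}"
      by (simp add: words_with_def)
  qed
  finally have "card ?R = card {u \<in> words_with ?v b k. descents_to_minima u}"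
    by (simp only: card_image[OF inj_on_Cons1])
  then have "real (card ?R) = (\<Sum>j \<in> (\<Pi>\<^sub>E i\<in>{2..k}. {0..b i}).
      (\<Prod>i=2..k. (real (b 1) + (\<Sum>r=2..i-1. real (j r)) + real (b i - j i) - 1) gchoose (b i - j i)))"
    using sum_words_with[OF assms(1) mono, of b "\<lambda>_. 1"] by (simp only: mult_1_right sum_constant)
  also have "\<dots> = (\<Sum>j \<in> (\<Pi>\<^sub>E i\<in>{2..k}. {0..a i}).
      \<Prod>i=2..k. (real (a 1) + (\<Sum>r=2..i-1. real (j r)) + real (a i) - real (j i) - 2)
        gchoose (a i - j i))"
  proof (rule sum.cong)
    show "(\<Pi>\<^sub>E i\<in>{2..k}. {0..b i}) = (\<Pi>\<^sub>E i\<in>{2..k}. {0..a i})"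
      by (rule PiE_cong) (simp add: b_def)
    fix j
    assume j: "j \<in> (\<Pi>\<^sub>E i\<in>{2..k}. {0..a i})"
    show "(\<Prod>i=2..k. (real (b 1) + (\<Sum>r=2..i-1. real (j r)) + real (b i - j i) - 1) gchoose (b i - j i)) =
      (\<Prod>i=2..k. (real (a 1) + (\<Sum>r=2..i-1. real (j r)) + real (a i) - real (j i) - 2)
        gchoose (a i - j i))"
    proof (rule prod.cong[OF refl])
      fix i
      assume i: "i \<in> {2..k}"
      then have "j i \<le> a i"
        using PiE_mem[OF j i] by simp
      then show "(real (b 1) + (\<Sum>r=2..i-1. real (j r)) + real (b i - j i) - 1) gchoose (b i - j i) =
        (real (a 1) + (\<Sum>r=2..i-1. real (j r)) + real (a i) - real (j i) - 2) gchoose (a i - j i)"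
        using a1 i by (simp add: b_def of_nat_diff algebra_simps)
    qed
  qed
  finally show ?thesis .
qed

end
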